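(* Let $\mathcal{X}\subseteq\mathbb{R}^d$ be a finite dataset, let $\mu^1,\ldots,\mu^k\in\mathbb{R}^d$ be reference centers, and run the ExKMC algorithm with these centers from some base threshold tree. Then the surrogate cost is non-increasing throughout the execution of ExKMC: if $T^{m}$ denotes the threshold tree with $m$ leaves held by the algorithm at some iteration and $T^{m+1}$ the tree obtained after the next split, then $$\widetilde{\mathrm{cost}}^{\mu^1,\ldots,\mu^k}(T^{m+1})\le \widetilde{\mathrm{cost}}^{\mu^1,\ldots,\mu^k}(T^{m}).$$
   Context: A threshold tree $T$ is a binary tree in which each internal node carries a pair $(i,\theta)$ with feature $i\in[d]$ and threshold $\theta\in\mathbb{R}$; a point $x$ goes to the left child if $x_i\le\theta$ and to the right child otherwise. A tree with $m$ leaves partitions $\mathcal{X}$ into the sets $\widehat C^1,\ldots,\widehat C^{m}$ of points reaching each leaf. Surrogate cost: for fixed reference centers $\mu^1,\ldots,\mu^k$, $$\widetilde{\mathrm{cost}}^{\mu^1,\ldots,\mu^k}(T)=\sum_{j=1}^{m}\ \min_{i\in[k]}\ \sum_{x\in\widehat C^j}\|x-\mu^i\|_2^2 .$$ For a set $A\subseteq\mathcal{X}$ write $\widetilde{\mathrm{cost}}(A)=\min_{i\in[k]}\sum_{x\in A}\|x-\mu^i\|_2^2$. ExKMC algorithm. Input: $\mathcal{X}$, reference centers $\mu^1,\ldots,\mu^k$, a base threshold tree $T$ (possibly a single leaf), and a target number of leaves $k'$. While the tree has fewer than $k'$ leaves: for each leaf with point set $A$ consider the splits $(i,\theta)$ of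 $A$ into $A_L=\{x\in A: x_i\le\theta\}$ and $A_R=\{x\in A:x_i>\theta\}$; the gain of the leaf is $\widetilde{\mathrm{cost}}(A)-\min_{i,\theta}\big(\widetilde{\mathrm{cost}}(A_L)+\widetilde{\mathrm{cost}}(A_R)\big)$. Pick the leaf with largest gain and replace it by an internal node with its best split $(i,\theta)$ and two new leaf children, each child labeled by the reference center minimizing the sum of squared distances to the points in that child. Output the resulting tree. *)

theory Defs
  imports "HOL-Analysis.Analysis"
begin

text \<open>The features are the indices \<open>'d\<close> of the ambient space \<open>real ^ 'd\<close>. A leaf carries the index
  of the reference center that labels it; the surrogate cost ignores these labels.\<close>

datatype 'd threshold_tree =
  Leaf nat
| Node 'd real "'d threshold_tree" "'d threshold_tree"

fun num_leaves :: "'d threshold_tree \<Rightarrow> nat" where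
  "num_leaves (Leaf c) = 1"
| "num_leaves (Node i \<theta> l r) = num_leaves l + num_leaves r"

text \<open>The leaves of \<open>T\<close> are numbered from left to right by \<open>0, \<dots>, num_leaves T - 1\<close>.\<close>

fun leaf_of :: "('d::finite) threshold_tree \<Rightarrow> real ^ 'd \<Rightarrow> nat" where
  "leaf_of (Leaf c) x = 0"
| "leaf_of (Node i \<theta> l r) x =
     (if x $ i \<le> \<theta> then leaf_of l x else num_leaves l + leaf_of r x)"

fun replace_leaf :: "'d threshold_tree \<Rightarrow> nat \<Rightarrow> 'd threshold_tree \<Rightarrow> 'd threshold_tree" where
  "replace_leaf (Leaf c) j S = S"
| "replace_leaf (Node i \<theta> l r) j S =
     (if j < num_leaves l then Node i \<theta> (replace_leaf l j S) r
      else Node i \<theta> l (replace_leaf r (j - num_leaves l) S))"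

definition cluster ::
    "(real ^ 'd) set \<Rightarrow> ('d::finite) threshold_tree \<Rightarrow> nat \<Rightarrow> (real ^ 'd) set" where
  "cluster X T j = {x \<in> X. leaf_of T x = j}"

definition center_cost :: "(nat \<Rightarrow> real ^ 'd) \<Rightarrow> (real ^ 'd) set \<Rightarrow> nat \<Rightarrow> real" where
  "center_cost \<mu> A i = (\<Sum>x\<in>A. (norm (x - \<mu> i))\<^sup>2)"

definition set_cost :: "(nat \<Rightarrow> real ^ 'd) \<Rightarrow> nat \<Rightarrow> (real ^ 'd) set \<Rightarrow> real" where
  "set_cost \<mu> k A = (MIN i\<in>{1..k}. center_cost \<mu> A i)"

definition surrogate_cost ::
    "(real ^ 'd) set \<Rightarrow> (nat \<Rightarrow> real ^ 'd) \<Rightarrow> nat \<Rightarrow> ('d::finite) threshold_tree \<Rightarrow> real" where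
  "surrogate_cost X \<mu> k T = (\<Sum>j<num_leaves T. set_cost \<mu> k (cluster X T j))"

definition left_part :: "(real ^ 'd) set \<Rightarrow> 'd \<Rightarrow> real \<Rightarrow> (real ^ 'd) set" where
  "left_part A i \<theta> = {x \<in> A. x $ i \<le> \<theta>}"

definition right_part :: "(real ^ 'd) set \<Rightarrow> 'd \<Rightarrow> real \<Rightarrow> (real ^ 'd) set" where
  "right_part A i \<theta> = {x \<in> A. x $ i > \<theta>}"

definition split_cost ::
    "(nat \<Rightarrow> real ^ 'd) \<Rightarrow> nat \<Rightarrow> (real ^ 'd) set \<Rightarrow> 'd \<times> real \<Rightarrow> real" where
  "split_cost \<mu> k A = (\<lambda>(i, \<theta>). set_cost \<mu> k (left_part A i \<theta>) + set_cost \<mu> k (right_part A i \<theta>))"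

text \<open>For finite \<open>A\<close> the infinitely many splits take only finitely many costs
  (lemma \<open>finite_range_split_cost\<close>), so the minimum is attained. Splits with an empty side are
  allowed; an empty set has cost 0.\<close>

definition gain ::
    "(nat \<Rightarrow> real ^ 'd) \<Rightarrow> nat \<Rightarrow> (real ^ 'd) set \<Rightarrow> real" where
  "gain \<mu> k A = set_cost \<mu> k A - Min (range (split_cost \<mu> k A))"

text \<open>One pass through the loop body. It is a relation because ties between leaves, splits and
  labels may be broken arbitrarily.\<close>

definition exkmc_step ::
    "(real ^ 'd) set \<Rightarrow> (nat \<Rightarrow> real ^ 'd) \<Rightarrow> nat \<Rightarrow> ('d::finite) threshold_tree \<Rightarrow>
     'd threshold_tree \<Rightarrow> bool" where
  "exkmc_step X \<mu> k T T' \<longleftrightarrow>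
     (\<exists>j i \<theta> a b.
        is_arg_max (\<lambda>j. gain \<mu> k (cluster X T j)) (\<lambda>j. j < num_leaves T) j \<and>
        is_arg_min (split_cost \<mu> k (cluster X T j)) (\<lambda>_. True) (i, \<theta>) \<and>
        is_arg_min (center_cost \<mu> (left_part (cluster X T j) i \<theta>)) (\<lambda>c. c \<in> {1..k}) a \<and>
        is_arg_min (center_cost \<mu> (right_part (cluster X T j) i \<theta>)) (\<lambda>c. c \<in> {1..k}) b \<and>
        T' = replace_leaf T j (Node i \<theta> (Leaf a) (Leaf b)))"

text \<open>\<open>T m\<close> is the tree with \<open>m\<close> leaves held by the algorithm (lemma \<open>num_leaves_exkmc_run\<close>);
  only the values for \<open>m\<close> between \<open>num_leaves T0\<close> and \<open>k'\<close> are meaningful.\<close>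

definition exkmc_run ::
    "(real ^ 'd) set \<Rightarrow> (nat \<Rightarrow> real ^ 'd) \<Rightarrow> nat \<Rightarrow> nat \<Rightarrow> ('d::finite) threshold_tree \<Rightarrow>
     (nat \<Rightarrow> 'd threshold_tree) \<Rightarrow> bool" where
  "exkmc_run X \<mu> k k' T0 T \<longleftrightarrow>
     T (num_leaves T0) = T0 \<and>
     (\<forall>m. num_leaves T0 \<le> m \<and> m < k' \<longrightarrow> exkmc_step X \<mu> k (T m) (T (Suc m)))"

lemma num_leaves_pos: "num_leaves T > 0"
  by (induction T) auto

lemma num_leaves_replace_leaf:
  "j < num_leaves T \<Longrightarrow> Suc (num_leaves (replace_leaf T j S)) = num_leaves T + num_leaves S"
  by (induction T arbitrary: j) force+

lemma num_leaves_exkmc_step: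
  assumes "exkmc_step X \<mu> k T T'"
  shows "num_leaves T' = Suc (num_leaves T)"
proof -
  obtain j i \<theta> a b where "j < num_leaves T"
    and T': "T' = replace_leaf T j (Node i \<theta> (Leaf a) (Leaf b))"
    using assms unfolding exkmc_step_def is_arg_max_def by blast
  then have "Suc (num_leaves T') = num_leaves T + 2"
    using num_leaves_replace_leaf[of j T "Node i \<theta> (Leaf a) (Leaf b)"] by simp
  then show ?thesis by simp
qed

lemma num_leaves_exkmc_run:
  assumes run: "exkmc_run X \<mu> k k' T0 T" and "num_leaves T0 \<le> m" and "m \<le> k'"
  shows "num_leaves (T m) = m"
  using assms(2,3)
proof (induction m rule: dec_induct)
  case base
  then show ?case using run by (simp add: exkmc_run_def)
next
  case (step n)
  then have "exkmc_step X \<mu> k (T n) (T (Suc n))" "num_leaves (T n) = n"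
    using run by (auto simp: exkmc_run_def)
  then show ?case using num_leaves_exkmc_step by metis
qed

lemma finite_range_split_cost:
  assumes "finite A"
  shows "finite (range (split_cost \<mu> k A))"
proof (rule finite_subset)
  show "range (split_cost \<mu> k A) \<subseteq> (\<lambda>(L, R). set_cost \<mu> k L + set_cost \<mu> k R) ` (Pow A \<times> Pow A)"
  proof
    fix y assume "y \<in> range (split_cost \<mu> k A)"
    then obtain i \<theta> where "y = set_cost \<mu> k (left_part A i \<theta>) + set_cost \<mu> k (right_part A i \<theta>)"
      by (auto simp: split_cost_def)
    moreover have "(left_part A i \<theta>, right_part A i \<theta>) \<in> Pow A \<times> Pow A"
      by (auto simp: left_part_def right_part_def)
    ultimately show "y \<in> (\<lambda>(L, R). set_cost \<mu> k L + set_cost \<mu> k R) ` (Pow A \<times> Pow A)"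
      by (metis (no_types, lifting) case_prod_conv image_eqI)
  qed
  show "finite ((\<lambda>(L, R). set_cost \<mu> k L + set_cost \<mu> k R) ` (Pow A \<times> Pow A))"
    using assms by simp
qed

lemma exkmc_step_exists:
  fixes X :: "(real ^ 'd::finite) set"
  assumes "finite X" and "1 \<le> k"
  shows "\<exists>T'. exkmc_step X \<mu> k T T'"
proof -
  have arg_min: "\<exists>c. is_arg_min f (\<lambda>c. c \<in> {1..k}) c" for f :: "nat \<Rightarrow> real"
    using ex_is_arg_min_if_finite[of "{1..k}" f] assms(2) by auto
  have "\<exists>j. is_arg_min (\<lambda>j. - gain \<mu> k (cluster X T j)) (\<lambda>j. j \<in> {..<num_leaves T}) j"
    by (rule ex_is_arg_min_if_finite) (use num_leaves_pos[of T] in auto)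
  then obtain j where
    "is_arg_max (\<lambda>j. gain \<mu> k (cluster X T j)) (\<lambda>j. j < num_leaves T) j"
    by (auto simp: is_arg_max_def is_arg_min_def)
  moreover have fin: "finite (range (split_cost \<mu> k (cluster X T j)))"
    by (rule finite_range_split_cost) (simp add: cluster_def assms(1))
  have "Min (range (split_cost \<mu> k (cluster X T j))) \<in> range (split_cost \<mu> k (cluster X T j))"
    by (rule Min_in) (use fin in auto)
  then obtain p where "split_cost \<mu> k (cluster X T j) p = Min (range (split_cost \<mu> k (cluster X T j)))"
    by (metis imageE)
  then have "is_arg_min (split_cost \<mu> k (cluster X T j)) (\<lambda>_. True) (fst p, snd p)"
    using fin by (auto simp: is_arg_min_linorder)
  moreover obtain a b where
    "is_arg_min (center_cost \<mu> (left_part (cluster X T j) (fst p) (snd p))) (\<lambda>c. c \<in> {1..k}) a"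
    "is_arg_min (center_cost \<mu> (right_part (cluster X T j) (fst p) (snd p))) (\<lambda>c. c \<in> {1..k}) b"
    using arg_min by metis
  ultimately show ?thesis
    unfolding exkmc_step_def by blast
qed

end

theory Submission
  imports Defs
begin

text \<open>The surrogate cost is additive over the leaves, so a step only exchanges the cost of one
  cluster \<open>A\<close> for the costs of its two parts. Every center pays for \<open>A\<close> exactly what it pays for
  the parts together, hence choosing the center separately for each part costs at most as much.
  Neither the choice of the leaf nor that of the split matters.\<close>

text \<open>Keeps the index ranges of the two subtrees of a node disjoint.\<close>

lemma leaf_of_less: "leaf_of T x < num_leaves T"
  by (induction T) (auto simp: num_leaves_pos trans_less_add1)

lemma cluster_Leaf: "cluster X (Leaf c) 0 = X"
  by (simp add: cluster_def)

lemma cluster_Node_left: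
  "j < num_leaves l \<Longrightarrow> cluster X (Node i \<theta> l r) j = cluster (left_part X i \<theta>) l j"
  by (auto simp: cluster_def left_part_def)

lemma cluster_Node_right:
  "cluster X (Node i \<theta> l r) (num_leaves l + j) = cluster (right_part X i \<theta>) r j"
proof -
  \<comment> \<open>Excludes points sent to the left: their index stays below the offset
    \<open>num_leaves l\<close>.\<close>
  have "leaf_of l x \<noteq> num_leaves l + j" for x
    using leaf_of_less[of l x] by simp
  then show ?thesis by (auto simp: cluster_def right_part_def)
qed

lemma surrogate_cost_Leaf: "surrogate_cost X \<mu> k (Leaf c) = set_cost \<mu> k X"
  by (simp add: surrogate_cost_def cluster_Leaf)

lemma sum_lessThan_add:
  fixes f :: "nat \<Rightarrow> 'a::comm_monoid_add"
  shows "sum f {..<m + n} = sum f {..<m} + (\<Sum>j<n. f (m + j))"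
  by (induction n) (auto simp: add.assoc)

text \<open>The sum over leaves breaks at \<open>num_leaves l\<close>, and each subtree sees only
  the points sent to it. This recursion permits induction on the tree.\<close>

lemma surrogate_cost_Node:
  "surrogate_cost X \<mu> k (Node i \<theta> l r) =
     surrogate_cost (left_part X i \<theta>) \<mu> k l + surrogate_cost (right_part X i \<theta>) \<mu> k r"
  by (simp add: surrogate_cost_def sum_lessThan_add cluster_Node_left cluster_Node_right)

text \<open>Leaf \<open>j\<close> lies in one of the two subtrees and the other contributes the same
  before and after; at the leaf itself, \<open>S\<close> receives exactly the points of its
  cluster.\<close>

lemma surrogate_cost_replace_leaf:
  assumes "j < num_leaves T"
  shows "surrogate_cost X \<mu> k (replace_leaf T j S) + set_cost \<mu> k (cluster X T j) =
         surrogate_cost X \<mu> k T + surrogate_cost (cluster X T j) \<mu> k S"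
  using assms
\<comment> \<open>\<open>X\<close> varies because a subtree is evaluated on its part of the data,
  \<open>j\<close> because the numbering restarts in the right subtree.\<close>
proof (induction T arbitrary: X j)
  case (Leaf c)
  then show ?case by (simp add: cluster_Leaf surrogate_cost_Leaf)
next
  case (Node i \<theta> l r)
  show ?case
  proof (cases "j < num_leaves l")
    case True
    with Node.IH(1)[of j "left_part X i \<theta>"] show ?thesis
      by (simp add: surrogate_cost_Node cluster_Node_left)
  next
    case False
    with Node.prems have "j - num_leaves l < num_leaves r" by simp
    moreover have "cluster X (Node i \<theta> l r) j = cluster (right_part X i \<theta>) r (j - num_leaves l)"
      using cluster_Node_right[of X i \<theta> l r "j - num_leaves l"] False by simp
    ultimately show ?thesis
      using Node.IH(2)[of "j - num_leaves l" "right_part X i \<theta>"] False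
      by (simp add: surrogate_cost_Node)
  qed
qed

lemma center_cost_split:
  assumes "finite A"
  shows "center_cost \<mu> (left_part A i \<theta>) c + center_cost \<mu> (right_part A i \<theta>) c = center_cost \<mu> A c"
proof -
  have "A = left_part A i \<theta> \<union> right_part A i \<theta>" "left_part A i \<theta> \<inter> right_part A i \<theta> = {}"
    by (auto simp: left_part_def right_part_def)
  moreover have "finite (left_part A i \<theta>)" "finite (right_part A i \<theta>)"
    using assms by (auto simp: left_part_def right_part_def)
  ultimately show ?thesis
    unfolding center_cost_def by (metis sum.union_disjoint)
qed

lemma set_cost_le: "c \<in> {1..k} \<Longrightarrow> set_cost \<mu> k A \<le> center_cost \<mu> A c"
  by (simp add: set_cost_def)

lemma set_cost_attained:
  assumes "1 \<le> k"
  obtains c where "c \<in> {1..k}" "set_cost \<mu> k A = center_cost \<mu> A c"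
proof -
  have "set_cost \<mu> k A \<in> center_cost \<mu> A ` {1..k}"
    unfolding set_cost_def by (rule Min_in) (use assms in auto)
  with that show ?thesis by blast
qed

lemma set_cost_split_le:
  assumes "finite A" and "1 \<le> k"
  shows "set_cost \<mu> k (left_part A i \<theta>) + set_cost \<mu> k (right_part A i \<theta>) \<le> set_cost \<mu> k A"
proof -
  \<comment> \<open>An optimal center for \<open>A\<close> is a candidate, perhaps not the best one,
    for both parts.\<close>
  obtain c where c: "c \<in> {1..k}" "set_cost \<mu> k A = center_cost \<mu> A c"
    using set_cost_attained[OF \<open>1 \<le> k\<close>] .
  with set_cost_le[OF c(1)] center_cost_split[OF \<open>finite A\<close>] show ?thesis
    by (metis add_mono)
qed

lemma surrogate_cost_exkmc_step:
  assumes "finite X" and "1 \<le> k" and "exkmc_step X \<mu> k T T'"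
  shows "surrogate_cost X \<mu> k T' \<le> surrogate_cost X \<mu> k T"
proof -
  obtain j i \<theta> a b where "j < num_leaves T"
    and T': "T' = replace_leaf T j (Node i \<theta> (Leaf a) (Leaf b))"
    using assms(3) unfolding exkmc_step_def is_arg_max_def by blast
  have "finite (cluster X T j)"
    using \<open>finite X\<close> by (simp add: cluster_def)
  then have "surrogate_cost (cluster X T j) \<mu> k (Node i \<theta> (Leaf a) (Leaf b))
      \<le> set_cost \<mu> k (cluster X T j)"
    using set_cost_split_le \<open>1 \<le> k\<close> by (simp add: surrogate_cost_Node surrogate_cost_Leaf)
  \<comment> \<open>The cost of the old cluster cancels between the exchange identity and the bound
    on its split.\<close>
  with surrogate_cost_replace_leaf[OF \<open>j < num_leaves T\<close>] show ?thesis
    unfolding T' by (smt (verit))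
qed

theorem theorem1:
  fixes X :: "(real ^ 'd::finite) set"
    and \<mu> :: "nat \<Rightarrow> real ^ 'd"
    and k k' m :: nat
    and T0 :: "'d threshold_tree"
    and T :: "nat \<Rightarrow> 'd threshold_tree"
  assumes "finite X"
    and "1 \<le> k"
    and "exkmc_run X \<mu> k k' T0 T"
    and "num_leaves T0 \<le> m" and "m < k'"
  shows "surrogate_cost X \<mu> k (T (m + 1)) \<le> surrogate_cost X \<mu> k (T m)"
  using assms surrogate_cost_exkmc_step[of X k \<mu> "T m" "T (m + 1)"]
  by (simp add: exkmc_run_def)

end
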